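(* Let $G$ be a connected graph, $r$ a vertex of $G$, $t\ge 1$, and $E_r$ a set of edges of $G$ each joining two neighbors of $r$. Suppose $G-r-E_r$ has connected components $G_1,\dots,G_j$ with $j>1$, and let $G'_i$ be the subgraph of $G$ induced by $V(G_i)\cup\{r\}$. Then \[\pi_t(G,r)=\max\Big\{\sum_{i=1}^j \pi_{t_i}(G'_i,r)-j+1\ :\ t_1,\dots,t_j \text{ positive integers},\ \sum_{i=1}^j t_i=t+j-1\Big\}.\]
   Context: A configuration on a graph $H$ is $C:V(H)\to\mathbb{N}$ with size $\sum_vC(v)$; a pebbling step from a vertex with at least two pebbles to a neighbor removes two pebbles there and adds one to the neighbor. $C$ is $t$-fold $r$-solvable if some sequence of pebbling steps places at least $t$ pebbles on $r$; $\pi_t(H,r)$ is the least $m$ such that every configuration of size $m$ on $H$ is $t$-fold $r$-solvable. *)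

theory Defs
  imports "Graph_Theory.Digraph_Component"
begin

text \<open>
  Finite simple graphs are symmetric loop-free digraphs without parallel arcs (locale
  \<open>graph\<close>). An undirected edge is the set \<open>{u, v}\<close> of its endpoints, so each edge
  corresponds to two mutually reverse arcs, and deleting it deletes both.
\<close>

definition edges :: "('a, 'b) pre_digraph \<Rightarrow> 'a set set" where
  "edges G = {{tail G a, head G a} | a. a \<in> arcs G}"

definition del_edges :: "('a, 'b) pre_digraph \<Rightarrow> 'a set set \<Rightarrow> ('a, 'b) pre_digraph" where
  "del_edges G F = G\<lparr>arcs := {a \<in> arcs G. {tail G a, head G a} \<notin> F}\<rparr>"

definition components :: "('a, 'b) pre_digraph \<Rightarrow> ('a, 'b) pre_digraph set" where
  "components G = {H. pre_digraph.max_subgraph G Digraph_Component.connected H}"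

text \<open>
  A configuration is a total function; its values outside \<open>verts G\<close> do not contribute to the
  size and are never touched by a pebbling step.
\<close>

definition config_size :: "('a, 'b) pre_digraph \<Rightarrow> ('a \<Rightarrow> nat) \<Rightarrow> nat" where
  "config_size G C = (\<Sum>v\<in>verts G. C v)"

definition pebbling_step :: "('a, 'b) pre_digraph \<Rightarrow> ('a \<Rightarrow> nat) \<Rightarrow> ('a \<Rightarrow> nat) \<Rightarrow> bool" where
  "pebbling_step G C D \<longleftrightarrow>
     (\<exists>u v. u \<rightarrow>\<^bsub>G\<^esub> v \<and> 2 \<le> C u \<and> D = C(u := C u - 2, v := C v + 1))"

definition fold_solvable :: "('a, 'b) pre_digraph \<Rightarrow> 'a \<Rightarrow> nat \<Rightarrow> ('a \<Rightarrow> nat) \<Rightarrow> bool" where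
  "fold_solvable G r t C \<longleftrightarrow> (\<exists>D. (pebbling_step G)\<^sup>*\<^sup>* C D \<and> t \<le> D r)"

definition pebbling_number :: "nat \<Rightarrow> ('a, 'b) pre_digraph \<Rightarrow> 'a \<Rightarrow> nat" where
  "pebbling_number t G r = (LEAST m. \<forall>C. config_size G C = m \<longrightarrow> fold_solvable G r t C)"

end

theory Submission
  imports Defs
begin

text \<open>
  Pebbling steps out of the root, or out of a neighbour of the root into another part, are
  dispensable: in the second case the pebble may as well go to the root, and a pebble lying at the
  root is worth at least a pebble lying anywhere else. Hence the number of pebbles that a
  configuration on \<open>G\<close> can bring to \<open>r\<close> is the sum of the numbers that its restrictions to the
  \<open>G\<^sub>i'\<close> can bring there, if each pebble on \<open>r\<close> is assigned to one of the restrictions. The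
  configuration is therefore not \<open>t\<close>-fold solvable iff, for some \<open>t\<^sub>i \<ge> 1\<close> with
  \<open>\<Sum>\<^sub>i (t\<^sub>i - 1) = t - 1\<close>, none of its restrictions is \<open>t\<^sub>i\<close>-fold solvable; it remains to choose
  configurations of maximal size on both sides.
\<close>

section \<open>Pebbling steps and pebbling numbers\<close>

lemma rtranclp_map:
  assumes "R\<^sup>*\<^sup>* x y" "\<And>a b. R a b \<Longrightarrow> S (h a) (h b)"
  shows "S\<^sup>*\<^sup>* (h x) (h y)"
  using assms(1) by induction (auto intro: rtranclp.rtrancl_into_rtrancl assms(2))

lemma pebbling_step_add:
  assumes "pebbling_step G C D"
  shows "pebbling_step G (\<lambda>v. C v + E v) (\<lambda>v. D v + E v)"
proof -
  obtain u v where "u \<rightarrow>\<^bsub>G\<^esub> v" "2 \<le> C u" "D = C(u := C u - 2, v := C v + 1)"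
    using assms unfolding pebbling_step_def by blast
  then show ?thesis
    unfolding pebbling_step_def by (intro exI[of _ u] exI[of _ v]) (auto simp: fun_eq_iff)
qed

lemma pebbling_steps_add:
  assumes "(pebbling_step G)\<^sup>*\<^sup>* C D"
  shows "(pebbling_step G)\<^sup>*\<^sup>* (\<lambda>v. C v + E v) (\<lambda>v. D v + E v)"
  by (rule rtranclp_map[OF assms]) (rule pebbling_step_add)

lemma repeated_pebbling_step:
  assumes "u \<rightarrow>\<^bsub>G\<^esub> v" "u \<noteq> v" "2 * k \<le> C u"
  shows "(pebbling_step G)\<^sup>*\<^sup>* C (C(u := C u - 2 * k, v := C v + k))"
  using assms(3)
proof (induction k)
  case 0
  then show ?case by simp
next
  case (Suc k)
  let ?D = "C(u := C u - 2 * k, v := C v + k)"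
  have "2 * k \<le> C u" using Suc.prems by simp
  then have "(pebbling_step G)\<^sup>*\<^sup>* C ?D" by (rule Suc.IH)
  moreover have "pebbling_step G ?D (C(u := C u - 2 * Suc k, v := C v + Suc k))"
    unfolding pebbling_step_def using assms(1,2) Suc.prems
    by (intro exI[of _ u] exI[of _ v]) (auto simp: fun_eq_iff)
  ultimately show ?case by (blast intro: rtranclp.rtrancl_into_rtrancl)
qed

lemma fold_solvable_0: "fold_solvable G r 0 C"
  unfolding fold_solvable_def by blast

lemma fold_solvable_le:
  assumes "fold_solvable G r t C" "s \<le> t"
  shows "fold_solvable G r s C"
  using assms unfolding fold_solvable_def by (meson le_trans)

lemma ex_max_fold_solvable:
  assumes "\<not> fold_solvable G r t C"
  shows "\<exists>s. fold_solvable G r s C \<and> \<not> fold_solvable G r (Suc s) C"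
  using ex_least_nat_less[of "\<lambda>n. \<not> fold_solvable G r n C" t] assms
  by (auto simp: fold_solvable_0)

lemma pebbling_steps_fold_solvable:
  assumes "(pebbling_step G)\<^sup>*\<^sup>* C D" "fold_solvable G r t D"
  shows "fold_solvable G r t C"
  using assms unfolding fold_solvable_def by (meson rtranclp_trans)

lemma fold_solvable_mono:
  assumes "fold_solvable G r t C" "\<And>v. C v \<le> C' v"
  shows "fold_solvable G r t C'"
proof -
  obtain D where D: "(pebbling_step G)\<^sup>*\<^sup>* C D" "t \<le> D r"
    using assms(1) unfolding fold_solvable_def by blast
  have "(\<lambda>v. C v + (C' v - C v)) = C'"
    using assms(2) by simp
  then have "(pebbling_step G)\<^sup>*\<^sup>* C' (\<lambda>v. D v + (C' v - C v))"
    using pebbling_steps_add[OF D(1), of "\<lambda>v. C' v - C v"] by simp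
  then show ?thesis
    unfolding fold_solvable_def using D(2) trans_le_add1 by blast
qed

lemma ex_subconfig_of_size:
  assumes "finite (verts G)" "m \<le> config_size G C"
  obtains C' where "\<And>v. C' v \<le> C v" "config_size G C' = m"
proof -
  have "\<exists>C'. (\<forall>v. C' v \<le> C v) \<and> config_size G C' = m"
    using assms(2)
  proof (induction m)
    case 0
    then show ?case by (intro exI[of _ "\<lambda>_. 0"]) (simp add: config_size_def)
  next
    case (Suc m)
    then obtain C' where C': "\<forall>v. C' v \<le> C v" "config_size G C' = m" by auto
    then have "\<exists>v\<in>verts G. C' v < C v"
      using Suc.prems unfolding config_size_def by (metis not_less not_less_eq_eq order.refl sum_mono)
    then obtain v where v: "v \<in> verts G" "C' v < C v" by blast
    have "config_size G (C'(v := C' v + 1)) = (\<Sum>w\<in>verts G. C' w + (if w = v then 1 else 0))"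
      unfolding config_size_def by (intro sum.cong) auto
    also have "\<dots> = Suc m"
      using C' v assms(1) by (simp add: sum.distrib config_size_def)
    finally have "config_size G (C'(v := C' v + 1)) = Suc m" .
    moreover have "\<forall>w. (C'(v := C' v + 1)) w \<le> C w"
      using C'(1) v(2) by auto
    ultimately show ?case by blast
  qed
  then show ?thesis using that by blast
qed

locale rooted_digraph = fin_digraph G + loopfree_digraph G for G :: "('a, 'b) pre_digraph" +
  fixes r :: 'a
  assumes root_in_verts: "r \<in> verts G"
    and reachable_root: "\<And>v. v \<in> verts G \<Longrightarrow> v \<rightarrow>\<^sup>*\<^bsub>G\<^esub> r"
begin

lemma adj_neq: "u \<rightarrow>\<^bsub>G\<^esub> v \<Longrightarrow> u \<noteq> v"
  using adj_not_same by blast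

lemma enough_pebbles_at_vertex:
  assumes "v \<in> verts G"
  shows "\<exists>K. \<forall>C. K \<le> C v \<longrightarrow> fold_solvable G r t C"
  using reachable_root[OF assms]
proof (induction rule: converse_reachable_induct)
  case base
  then show ?case unfolding fold_solvable_def by blast
next
  case (step u w)
  then obtain K where K: "\<And>C. K \<le> C w \<Longrightarrow> fold_solvable G r t C" by blast
  have "fold_solvable G r t C" if "2 * K \<le> C u" for C
  proof (rule pebbling_steps_fold_solvable)
    show "(pebbling_step G)\<^sup>*\<^sup>* C (C(u := C u - 2 * K, w := C w + K))"
      using step.hyps(1) adj_neq that by (intro repeated_pebbling_step)
  qed (simp add: K)
  then show ?case by blast
qed

lemma ex_solvable_size: "\<exists>m. \<forall>C. config_size G C = m \<longrightarrow> fold_solvable G r t C"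
proof -
  have "\<forall>v\<in>verts G. \<exists>K. \<forall>C. K \<le> C v \<longrightarrow> fold_solvable G r t C"
    using enough_pebbles_at_vertex by blast
  then obtain K where K: "\<forall>v\<in>verts G. \<forall>C. K v \<le> C v \<longrightarrow> fold_solvable G r t C"
    by (rule bchoice[THEN exE])
  have "fold_solvable G r t C" if "config_size G C = (\<Sum>v\<in>verts G. K v)" for C
  proof (rule ccontr)
    assume "\<not> fold_solvable G r t C"
    then have "C v < K v" if "v \<in> verts G" for v using K that not_le by blast
    then have "config_size G C < (\<Sum>v\<in>verts G. K v)"
      unfolding config_size_def using root_in_verts by (intro sum_strict_mono) auto
    then show False using that by simp
  qed
  then show ?thesis by blast
qed

lemma less_pebbling_number_iff:
  "m < pebbling_number t G r \<longleftrightarrow> (\<exists>C. config_size G C = m \<and> \<not> fold_solvable G r t C)"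
proof
  assume "m < pebbling_number t G r"
  then show "\<exists>C. config_size G C = m \<and> \<not> fold_solvable G r t C"
    unfolding pebbling_number_def by (blast dest: not_less_Least)
next
  assume "\<exists>C. config_size G C = m \<and> \<not> fold_solvable G r t C"
  then obtain C where C: "config_size G C = m" "\<not> fold_solvable G r t C" by blast
  show "m < pebbling_number t G r"
  proof (rule ccontr)
    assume "\<not> m < pebbling_number t G r"
    then obtain C' where C': "\<And>v. C' v \<le> C v" "config_size G C' = pebbling_number t G r"
      using ex_subconfig_of_size[OF finite_verts] C(1) not_less by metis
    have "fold_solvable G r t C'"
      using LeastI_ex[OF ex_solvable_size] C'(2) unfolding pebbling_number_def by blast
    then show False using fold_solvable_mono[of G r t C' C] C'(1) C(2) by blast
  qed
qed

lemma config_size_less_pebbling_number: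
  "\<not> fold_solvable G r t C \<Longrightarrow> config_size G C < pebbling_number t G r"
  unfolding less_pebbling_number_iff by blast

lemma ex_largest_unsolvable_config:
  assumes "t \<ge> 1"
  shows "\<exists>C. \<not> fold_solvable G r t C \<and> config_size G C + 1 = pebbling_number t G r"
proof -
  have "D = (\<lambda>_. 0)" if "(pebbling_step G)\<^sup>*\<^sup>* (\<lambda>_. 0) D" for D
    using that by (rule converse_rtranclpE) (auto simp: pebbling_step_def)
  then have "\<not> fold_solvable G r t (\<lambda>_. 0)"
    unfolding fold_solvable_def using assms by fastforce
  then have "pebbling_number t G r > 0"
    using config_size_less_pebbling_number by fastforce
  then show ?thesis
    using less_pebbling_number_iff[of "pebbling_number t G r - 1" t] by auto
qed

text \<open>
  The subtraction is truncated: the pebbles that \<open>D\<close> has off the root in excess of \<open>U\<close> are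
  compensated by extra pebbles of \<open>U\<close> at the root.
\<close>

definition root_covers :: "('a \<Rightarrow> nat) \<Rightarrow> ('a \<Rightarrow> nat) \<Rightarrow> bool" where
  "root_covers U D \<longleftrightarrow> D r + (\<Sum>v\<in>verts G - {r}. D v - U v) \<le> U r"

lemma root_covers_refl: "root_covers C C"
  by (simp add: root_covers_def)

lemma root_covers_idle:
  assumes "root_covers U D" "u \<rightarrow>\<^bsub>G\<^esub> v" "2 \<le> D u" "u = r \<or> U u < 2"
  shows "root_covers U (D(u := D u - 2, v := D v + 1))"
proof -
  let ?V = "verts G - {r}"
  define D' where "D' = D(u := D u - 2, v := D v + 1)"
  have uv: "u \<noteq> v" "u \<in> verts G" "v \<in> verts G"
    using adj_neq adj_in_verts assms(2) by auto
  have "(\<Sum>x\<in>?V. (D' x - U x) + (if x = u then 1 else 0))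
      \<le> (\<Sum>x\<in>?V. (D x - U x) + (if x = v then 1 else 0))"
    using assms(3,4) uv(1) by (intro sum_mono) (auto simp: D'_def)
  then have "(\<Sum>x\<in>?V. D' x - U x) + (if u = r then 0 else 1)
      \<le> (\<Sum>x\<in>?V. D x - U x) + (if v = r then 0 else 1)"
    using uv by (simp add: sum.distrib split: if_splits)
  moreover have "D' r + (if u = r then 2 else 0) = D r + (if v = r then 1 else 0)"
    using assms(3) uv(1) by (auto simp: D'_def)
  ultimately show ?thesis
    using assms(1) uv(1) unfolding root_covers_def D'_def[symmetric] by (auto split: if_splits)
qed

lemma root_covers_follow:
  assumes "root_covers U D" "u \<rightarrow>\<^bsub>G\<^esub> v" "2 \<le> D u" "u \<noteq> r" "2 \<le> U u" "w = v \<or> w = r"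
  shows "root_covers (U(u := U u - 2, w := U w + 1)) (D(u := D u - 2, v := D v + 1))"
proof -
  let ?V = "verts G - {r}"
  define D' U' where "D' = D(u := D u - 2, v := D v + 1)" and "U' = U(u := U u - 2, w := U w + 1)"
  have uv: "u \<noteq> v" "v \<in> verts G"
    using adj_neq adj_in_verts assms(2) by auto
  have "(\<Sum>x\<in>?V. D' x - U' x)
      \<le> (\<Sum>x\<in>?V. (D x - U x) + (if x = v then if w = v then 0 else 1 else 0))"
    using assms(4-6) uv(1) by (intro sum_mono) (auto simp: D'_def U'_def)
  then have "(\<Sum>x\<in>?V. D' x - U' x) \<le> (\<Sum>x\<in>?V. D x - U x) + (if w = v then 0 else 1)"
    using uv(2) by (simp add: sum.distrib split: if_splits)
  moreover have "D' r = D r + (if v = r then 1 else 0)" "U' r = U r + (if w = r then 1 else 0)"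
    using assms(4) by (auto simp: D'_def U'_def)
  ultimately show ?thesis
    using assms(1,6) unfolding root_covers_def D'_def[symmetric] U'_def[symmetric]
    by (auto split: if_splits)
qed

lemma fold_solvable_shortcut_to_root:
  assumes "fold_solvable G r t C"
    and shortcut: "\<And>u v. u \<rightarrow>\<^bsub>G\<^esub> v \<Longrightarrow> u \<noteq> r \<Longrightarrow> u \<rightarrow>\<^bsub>H\<^esub> v \<or> u \<rightarrow>\<^bsub>H\<^esub> r"
  shows "fold_solvable H r t C"
proof -
  obtain D where D: "(pebbling_step G)\<^sup>*\<^sup>* C D" "t \<le> D r"
    using assms(1) unfolding fold_solvable_def by blast
  from D(1) have "\<exists>U. (pebbling_step H)\<^sup>*\<^sup>* C U \<and> root_covers U D"
  proof (induction rule: rtranclp_induct)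
    case base
    then show ?case using root_covers_refl by blast
  next
    case (step D D')
    then obtain U where U: "(pebbling_step H)\<^sup>*\<^sup>* C U" "root_covers U D" by blast
    obtain u v where uv: "u \<rightarrow>\<^bsub>G\<^esub> v" "2 \<le> D u" and D': "D' = D(u := D u - 2, v := D v + 1)"
      using step.hyps(2) unfolding pebbling_step_def by blast
    show ?case
    proof (cases "u = r \<or> U u < 2")
      case True
      then show ?thesis using U root_covers_idle uv unfolding D' by blast
    next
      case False
      obtain w where w: "w = v \<or> w = r" "u \<rightarrow>\<^bsub>H\<^esub> w"
        using shortcut[OF uv(1)] False by blast
      let ?U = "U(u := U u - 2, w := U w + 1)"
      have "pebbling_step H U ?U"
        unfolding pebbling_step_def using w(2) False not_less by blast
      moreover have "root_covers ?U D'"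
        using root_covers_follow[OF U(2) uv] w(1) False unfolding D' by simp
      ultimately show ?thesis using U(1) by (blast intro: rtranclp.rtrancl_into_rtrancl)
    qed
  qed
  then obtain U where U: "(pebbling_step H)\<^sup>*\<^sup>* C U" "root_covers U D" by blast
  moreover have "t \<le> U r"
    using D(2) U(2) unfolding root_covers_def by linarith
  ultimately show ?thesis
    unfolding fold_solvable_def by blast
qed

end

section \<open>Splitting a digraph at the root\<close>

text \<open>
  The parts are encoded by a colouring \<open>f\<close> of the vertices other than \<open>r\<close>; its value at \<open>r\<close>
  is irrelevant.
\<close>

locale root_partition = rooted_digraph G r
  for G :: "('a, 'b) pre_digraph" and r +
  fixes I :: "'i set" and f :: "'a \<Rightarrow> 'i"
  assumes finite_I: "finite I"
    and color_in: "\<And>v. v \<in> verts G \<Longrightarrow> v \<noteq> r \<Longrightarrow> f v \<in> I"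
    and cross_adj_root:
      "\<And>u v. u \<rightarrow>\<^bsub>G\<^esub> v \<Longrightarrow> u \<noteq> r \<Longrightarrow> v \<noteq> r \<Longrightarrow> f u \<noteq> f v \<Longrightarrow> u \<rightarrow>\<^bsub>G\<^esub> r"
begin

definition part :: "'i \<Rightarrow> ('a, 'b) pre_digraph" where
  "part i = G \<restriction> ({v \<in> verts G. v \<noteq> r \<and> f v = i} \<union> {r})"

lemma verts_part: "verts (part i) = {v \<in> verts G. v \<noteq> r \<and> f v = i} \<union> {r}"
  by (simp add: part_def)

lemma adj_part_iff:
  "u \<rightarrow>\<^bsub>part i\<^esub> v \<longleftrightarrow> u \<rightarrow>\<^bsub>G\<^esub> v \<and> (u = r \<or> f u = i) \<and> (v = r \<or> f v = i)"
  unfolding part_def arcs_ends_conv by (auto simp: image_iff)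

lemma rooted_digraph_part: "rooted_digraph (part i) r"
proof -
  interpret P: wf_digraph "part i"
    unfolding part_def by (rule wellformed_induce_subgraph)
  interpret P: fin_digraph "part i"
    by unfold_locales (auto simp: part_def)
  interpret P: loopfree_digraph "part i"
    by unfold_locales (auto simp: part_def dest: no_loops)
  show ?thesis
  proof
    show root_in_part: "r \<in> verts (part i)" by (simp add: verts_part)
    fix v assume "v \<in> verts (part i)"
    then have "v = r \<or> f v = i" "v \<rightarrow>\<^sup>*\<^bsub>G\<^esub> r"
      using reachable_root root_in_verts by (auto simp: verts_part)
    from this(2,1) show "v \<rightarrow>\<^sup>*\<^bsub>part i\<^esub> r"
    proof (induction rule: converse_reachable_induct)
      case base
      show ?case using root_in_part by (rule P.reachable_refl)
    next
      case (step u w)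
      consider (root) "u = r" | (adj_root) "u \<noteq> r" "u \<rightarrow>\<^bsub>G\<^esub> r"
        | (same_part) "u \<noteq> r" "w = r \<or> f w = f u"
        using cross_adj_root[OF step.hyps(1)] by fastforce
      then show ?case
      proof cases
        case root
        then show ?thesis using root_in_part by (simp add: P.reachable_refl)
      next
        case adj_root
        then have "u \<rightarrow>\<^bsub>part i\<^esub> r" using step.prems by (simp add: adj_part_iff)
        then show ?thesis by auto
      next
        case same_part
        then have "u \<rightarrow>\<^bsub>part i\<^esub> w" "w = r \<or> f w = i"
          using step.hyps(1) step.prems by (auto simp: adj_part_iff)
        from this(1) step.IH[OF this(2)] show ?thesis by (rule P.adj_reachable_trans)
      qed
    qed
  qed
qed

sublocale part: rooted_digraph "part i" r for i
  by (rule rooted_digraph_part)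

definition glue :: "('i \<Rightarrow> 'a \<Rightarrow> nat) \<Rightarrow> 'a \<Rightarrow> nat" where
  "glue Cs v = (if v = r then \<Sum>i\<in>I. Cs i r else Cs (f v) v)"

lemma config_size_glue: "config_size G (glue Cs) = (\<Sum>i\<in>I. config_size (part i) (Cs i))"
proof -
  let ?V = "verts G - {r}"
  have "config_size (part i) (Cs i) = (\<Sum>v\<in>{v \<in> ?V. f v = i}. glue Cs v) + Cs i r" for i
  proof -
    have "verts (part i) = insert r {v \<in> ?V. f v = i}"
      by (auto simp: verts_part)
    then show ?thesis
      unfolding config_size_def by (auto simp: glue_def intro: sum.cong)
  qed
  moreover have "(\<Sum>i\<in>I. \<Sum>v\<in>{v \<in> ?V. f v = i}. glue Cs v) = (\<Sum>v\<in>?V. glue Cs v)"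
    by (intro sum.group) (use color_in finite_I in auto)
  moreover have "config_size G (glue Cs) = glue Cs r + (\<Sum>v\<in>?V. glue Cs v)"
    unfolding config_size_def using root_in_verts by (simp add: sum.remove)
  ultimately show ?thesis by (simp add: sum.distrib glue_def)
qed

lemma le_glue:
  assumes "i \<in> I" "v = r \<or> f v = i"
  shows "Cs i v \<le> glue Cs v"
  using assms finite_I by (auto simp: glue_def intro: member_le_sum)

lemma glue_pebble_move:
  assumes "i \<in> I" "u \<rightarrow>\<^bsub>part i\<^esub> v" "2 \<le> Cs i u"
  shows "glue (Cs(i := (Cs i)(u := Cs i u - 2, v := Cs i v + 1))) =
    (glue Cs)(u := glue Cs u - 2, v := glue Cs v + 1)"
proof
  fix x
  have root: "glue Es r = Es i r + (\<Sum>k\<in>I - {i}. Es k r)" for Es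
    unfolding glue_def using sum.remove[OF finite_I assms(1)] by simp
  show "glue (Cs(i := (Cs i)(u := Cs i u - 2, v := Cs i v + 1))) x =
    ((glue Cs)(u := glue Cs u - 2, v := glue Cs v + 1)) x"
  proof (cases "x = r")
    case True
    then show ?thesis using assms(3) by (cases "u = r"; cases "v = r") (simp_all add: root)
  next
    case False
    then show ?thesis using assms(2) by (auto simp: glue_def adj_part_iff)
  qed
qed

lemma pebbling_step_glue:
  assumes "i \<in> I" "pebbling_step (part i) (Cs i) D"
  shows "pebbling_step G (glue Cs) (glue (Cs(i := D)))"
proof -
  obtain u v where uv: "u \<rightarrow>\<^bsub>part i\<^esub> v" "2 \<le> Cs i u"
    and D: "D = (Cs i)(u := Cs i u - 2, v := Cs i v + 1)"
    using assms(2) unfolding pebbling_step_def by blast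
  have "u \<rightarrow>\<^bsub>G\<^esub> v" "2 \<le> glue Cs u"
    using uv le_glue[OF assms(1), of u Cs] by (auto simp: adj_part_iff)
  then show ?thesis
    unfolding pebbling_step_def D glue_pebble_move[of i u v Cs, OF assms(1) uv] by blast
qed

lemma pebbling_steps_glue:
  assumes "i \<in> I" "(pebbling_step (part i))\<^sup>*\<^sup>* (Cs i) D"
  shows "(pebbling_step G)\<^sup>*\<^sup>* (glue Cs) (glue (Cs(i := D)))"
proof -
  have step: "pebbling_step G (glue (Cs(i := E))) (glue (Cs(i := E')))"
    if "pebbling_step (part i) E E'" for E E'
    using pebbling_step_glue[OF assms(1), of "Cs(i := E)"] that by simp
  have "(pebbling_step G)\<^sup>*\<^sup>* (glue (Cs(i := Cs i))) (glue (Cs(i := D)))"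
    by (rule rtranclp_map[where h = "\<lambda>E. glue (Cs(i := E))", OF assms(2)]) (rule step)
  then show ?thesis by simp
qed

lemma pebbling_steps_glue_override_on:
  assumes "J \<subseteq> I" "\<And>i. i \<in> J \<Longrightarrow> (pebbling_step (part i))\<^sup>*\<^sup>* (Cs i) (Ds i)"
  shows "(pebbling_step G)\<^sup>*\<^sup>* (glue Cs) (glue (override_on Cs Ds J))"
  using finite_subset[OF assms(1) finite_I] assms
proof (induction J)
  case empty
  then show ?case by simp
next
  case (insert i J)
  let ?Es = "override_on Cs Ds J"
  have "(pebbling_step (part i))\<^sup>*\<^sup>* (?Es i) (Ds i)"
    using insert.hyps(2) insert.prems(2) by simp
  then have "(pebbling_step G)\<^sup>*\<^sup>* (glue ?Es) (glue (override_on Cs Ds (insert i J)))"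
    unfolding override_on_insert using insert.prems(1) by (intro pebbling_steps_glue) simp_all
  moreover have "(pebbling_step G)\<^sup>*\<^sup>* (glue Cs) (glue ?Es)"
    using insert.IH insert.prems by simp
  ultimately show ?case by (meson rtranclp_trans)
qed

text \<open>
  The arcs out of the root have to be dropped as well: two pebbles of \<open>glue Cs\<close> at the root may
  come from different parts, and then no part can imitate a step that uses them.
\<close>

definition inward :: "('a, 'b) pre_digraph" where
  "inward = G\<lparr>arcs := {a \<in> arcs G. tail G a \<noteq> r \<and> (head G a = r \<or> f (tail G a) = f (head G a))}\<rparr>"

lemma adj_inward_iff: "u \<rightarrow>\<^bsub>inward\<^esub> v \<longleftrightarrow> u \<rightarrow>\<^bsub>G\<^esub> v \<and> u \<noteq> r \<and> (v = r \<or> f u = f v)"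
  unfolding inward_def arcs_ends_conv by auto

lemma fold_solvable_inward:
  assumes "fold_solvable G r t C"
  shows "fold_solvable inward r t C"
  using assms
proof (rule fold_solvable_shortcut_to_root)
  show "u \<rightarrow>\<^bsub>inward\<^esub> v \<or> u \<rightarrow>\<^bsub>inward\<^esub> r" if "u \<rightarrow>\<^bsub>G\<^esub> v" "u \<noteq> r" for u v
    using that cross_adj_root by (auto simp: adj_inward_iff)
qed

lemma pebbling_step_inward_glue:
  assumes "pebbling_step inward (glue Cs) U"
  obtains i D where "pebbling_step (part i) (Cs i) D" "U = glue (Cs(i := D))"
proof -
  obtain u v where uv: "u \<rightarrow>\<^bsub>inward\<^esub> v" "2 \<le> glue Cs u"
    and U: "U = (glue Cs)(u := glue Cs u - 2, v := glue Cs v + 1)"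
    using assms unfolding pebbling_step_def by blast
  let ?i = "f u" and ?D = "(Cs (f u))(u := Cs (f u) u - 2, v := Cs (f u) v + 1)"
  have "?i \<in> I" "u \<rightarrow>\<^bsub>part ?i\<^esub> v" "2 \<le> Cs ?i u"
    using uv color_in adj_in_verts by (auto simp: adj_inward_iff adj_part_iff glue_def)
  moreover from this have "pebbling_step (part ?i) (Cs ?i) ?D"
    unfolding pebbling_step_def by blast
  ultimately show ?thesis
    using that[of ?i ?D] glue_pebble_move[of ?i u v Cs] unfolding U by simp
qed

lemma pebbling_steps_inward_glue:
  assumes "(pebbling_step inward)\<^sup>*\<^sup>* (glue Cs) U"
  shows "\<exists>Ds. (\<forall>i. (pebbling_step (part i))\<^sup>*\<^sup>* (Cs i) (Ds i)) \<and> U = glue Ds"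
  using assms
proof (induction rule: rtranclp_induct)
  case base
  then show ?case by blast
next
  case (step U U')
  then obtain Ds where Ds: "\<forall>i. (pebbling_step (part i))\<^sup>*\<^sup>* (Cs i) (Ds i)" "U = glue Ds" by blast
  obtain i D where D: "pebbling_step (part i) (Ds i) D" "U' = glue (Ds(i := D))"
    using step.hyps(2) unfolding Ds(2) by (rule pebbling_step_inward_glue)
  have "\<forall>k. (pebbling_step (part k))\<^sup>*\<^sup>* (Cs k) ((Ds(i := D)) k)"
    using Ds(1) D(1) by (auto intro: rtranclp.rtrancl_into_rtrancl)
  then show ?case using D(2) by blast
qed

lemma fold_solvable_glue_iff:
  "fold_solvable G r t (glue Cs) \<longleftrightarrow>
    (\<exists>s. (\<forall>i\<in>I. fold_solvable (part i) r (s i) (Cs i)) \<and> t \<le> (\<Sum>i\<in>I. s i))"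
proof
  assume "fold_solvable G r t (glue Cs)"
  then obtain U where U: "(pebbling_step inward)\<^sup>*\<^sup>* (glue Cs) U" "t \<le> U r"
    using fold_solvable_inward unfolding fold_solvable_def by blast
  then obtain Ds where "\<forall>i. (pebbling_step (part i))\<^sup>*\<^sup>* (Cs i) (Ds i)" "U = glue Ds"
    using pebbling_steps_inward_glue by blast
  then show "\<exists>s. (\<forall>i\<in>I. fold_solvable (part i) r (s i) (Cs i)) \<and> t \<le> (\<Sum>i\<in>I. s i)"
    using U(2) unfolding fold_solvable_def
    by (intro exI[of _ "\<lambda>i. Ds i r"]) (auto simp: glue_def)
next
  assume "\<exists>s. (\<forall>i\<in>I. fold_solvable (part i) r (s i) (Cs i)) \<and> t \<le> (\<Sum>i\<in>I. s i)"
  then obtain s where s: "\<forall>i\<in>I. fold_solvable (part i) r (s i) (Cs i)" "t \<le> (\<Sum>i\<in>I. s i)" by blast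
  then obtain Ds where Ds: "\<And>i. i \<in> I \<Longrightarrow> (pebbling_step (part i))\<^sup>*\<^sup>* (Cs i) (Ds i)"
      "\<And>i. i \<in> I \<Longrightarrow> s i \<le> Ds i r"
    unfolding fold_solvable_def by metis
  have "t \<le> (\<Sum>i\<in>I. Ds i r)"
    using s(2) Ds(2) by (meson le_trans sum_mono)
  also have "\<dots> = glue (override_on Cs Ds I) r"
    by (simp add: glue_def)
  finally show "fold_solvable G r t (glue Cs)"
    unfolding fold_solvable_def using pebbling_steps_glue_override_on[OF order.refl Ds(1)] by blast
qed

lemma fold_solvable_part_imp_glue:
  assumes "i \<in> I" "fold_solvable (part i) r t (Cs i)"
  shows "fold_solvable G r t (glue Cs)"
  unfolding fold_solvable_glue_iff using assms finite_I
  by (intro exI[of _ "\<lambda>k. if k = i then t else 0"]) (auto simp: fold_solvable_0)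

lemma not_fold_solvable_glueI:
  assumes "\<forall>i\<in>I. \<not> fold_solvable (part i) r (ts i) (Cs i)"
    and "(\<Sum>i\<in>I. ts i) < t + card I"
  shows "\<not> fold_solvable G r t (glue Cs)"
proof
  assume "fold_solvable G r t (glue Cs)"
  then obtain s where s: "\<forall>i\<in>I. fold_solvable (part i) r (s i) (Cs i)" "t \<le> (\<Sum>i\<in>I. s i)"
    unfolding fold_solvable_glue_iff by blast
  have "Suc (s i) \<le> ts i" if "i \<in> I" for i
    using s(1) assms(1) that fold_solvable_le[of "part i" r "s i" "Cs i" "ts i"]
    by (fastforce simp: Suc_le_eq not_le[symmetric])
  then have "(\<Sum>i\<in>I. Suc (s i)) \<le> (\<Sum>i\<in>I. ts i)"
    by (rule sum_mono)
  then show False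
    using s(2) assms(2) by (simp add: sum_Suc)
qed

lemma not_fold_solvable_glueD:
  assumes unsolv: "\<not> fold_solvable G r t (glue Cs)" and "I \<noteq> {}"
  shows "\<exists>ts. (\<forall>i\<in>I. \<not> fold_solvable (part i) r (ts i) (Cs i)) \<and>
    (\<Sum>i\<in>I. ts i) + 1 = t + card I"
proof -
  have "\<exists>s. fold_solvable (part i) r s (Cs i) \<and> \<not> fold_solvable (part i) r (Suc s) (Cs i)"
    if "i \<in> I" for i
  proof (rule ex_max_fold_solvable)
    show "\<not> fold_solvable (part i) r t (Cs i)"
      using fold_solvable_part_imp_glue[of i t Cs] that unsolv by blast
  qed
  then obtain s where s: "\<forall>i\<in>I. fold_solvable (part i) r (s i) (Cs i) \<and>
      \<not> fold_solvable (part i) r (Suc (s i)) (Cs i)"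
    using bchoice[of I "\<lambda>i n. fold_solvable (part i) r n (Cs i) \<and>
      \<not> fold_solvable (part i) r (Suc n) (Cs i)"] by blast
  then have "(\<Sum>i\<in>I. s i) < t"
    using unsolv unfolding fold_solvable_glue_iff by (meson not_le)
  then obtain d where d: "t = Suc ((\<Sum>i\<in>I. s i) + d)"
    using less_imp_Suc_add by blast
  obtain k where k: "k \<in> I" using \<open>I \<noteq> {}\<close> by blast
  define ts where "ts i = Suc (s i) + (if i = k then d else 0)" for i
  have "\<not> fold_solvable (part i) r (ts i) (Cs i)" if "i \<in> I" for i
  proof
    assume "fold_solvable (part i) r (ts i) (Cs i)"
    then have "fold_solvable (part i) r (Suc (s i)) (Cs i)"
      by (rule fold_solvable_le) (simp add: ts_def)
    then show False using s that by blast
  qed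
  moreover have "(\<Sum>i\<in>I. ts i) + 1 = t + card I"
    using k finite_I d by (simp add: ts_def sum_Suc sum.distrib)
  ultimately show ?thesis by blast
qed

lemma ex_glue_eq:
  assumes "I \<noteq> {}"
  shows "\<exists>Cs. C = glue Cs"
proof -
  obtain k where "k \<in> I" using assms by blast
  then have "C = glue (\<lambda>i. C(r := if i = k then C r else 0))"
    using finite_I by (auto simp: glue_def fun_eq_iff)
  then show ?thesis by blast
qed

lemma sum_pebbling_number_less:
  assumes "\<forall>i\<in>I. ts i \<ge> 1" "(\<Sum>i\<in>I. ts i) < t + card I"
  shows "(\<Sum>i\<in>I. pebbling_number (ts i) (part i) r) < pebbling_number t G r + card I"
proof -
  have "\<forall>i\<in>I. \<exists>C. \<not> fold_solvable (part i) r (ts i) C \<and>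
      config_size (part i) C + 1 = pebbling_number (ts i) (part i) r"
    using part.ex_largest_unsolvable_config assms(1) by blast
  then obtain Cs where Cs: "\<forall>i\<in>I. \<not> fold_solvable (part i) r (ts i) (Cs i) \<and>
      config_size (part i) (Cs i) + 1 = pebbling_number (ts i) (part i) r"
    by (rule bchoice[THEN exE])
  then have "\<not> fold_solvable G r t (glue Cs)"
    using assms(2) by (intro not_fold_solvable_glueI[of ts]) blast+
  then have less: "config_size G (glue Cs) < pebbling_number t G r"
    by (rule config_size_less_pebbling_number)
  have "(\<Sum>i\<in>I. pebbling_number (ts i) (part i) r) = (\<Sum>i\<in>I. config_size (part i) (Cs i) + 1)"
    using Cs by (intro sum.cong) auto
  also have "\<dots> = config_size G (glue Cs) + card I"
    by (simp add: sum_Suc config_size_glue)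
  finally show ?thesis using less by simp
qed

lemma ex_pebbling_number_le_sum:
  assumes "I \<noteq> {}" "t \<ge> 1"
  shows "\<exists>ts. (\<forall>i\<in>I. ts i \<ge> 1) \<and> (\<Sum>i\<in>I. ts i) + 1 = t + card I \<and>
    pebbling_number t G r + card I \<le> (\<Sum>i\<in>I. pebbling_number (ts i) (part i) r) + 1"
proof -
  obtain C where C: "\<not> fold_solvable G r t C" "config_size G C + 1 = pebbling_number t G r"
    using ex_largest_unsolvable_config[OF assms(2)] by blast
  obtain Cs where Cs: "C = glue Cs"
    using ex_glue_eq[OF assms(1)] by blast
  obtain ts where unsolv: "\<forall>i\<in>I. \<not> fold_solvable (part i) r (ts i) (Cs i)"
    and sum: "(\<Sum>i\<in>I. ts i) + 1 = t + card I"
    using not_fold_solvable_glueD[OF C(1)[unfolded Cs] assms(1)] by (elim exE conjE)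
  have "ts i \<ge> 1" if "i \<in> I" for i
    using unsolv that fold_solvable_0[of "part i" r "Cs i"] by (cases "ts i") auto
  moreover have "pebbling_number t G r + card I \<le> (\<Sum>i\<in>I. pebbling_number (ts i) (part i) r) + 1"
  proof -
    have "config_size G C + card I = (\<Sum>i\<in>I. config_size (part i) (Cs i) + 1)"
      by (simp add: sum_Suc Cs config_size_glue)
    also have "\<dots> \<le> (\<Sum>i\<in>I. pebbling_number (ts i) (part i) r)"
      using unsolv part.config_size_less_pebbling_number by (intro sum_mono) (simp add: Suc_leI)
    finally show ?thesis using C(2) by simp
  qed
  ultimately show ?thesis using sum by blast
qed

lemma pebbling_number_eq_Max:
  assumes "I \<noteq> {}" "t \<ge> 1"
  shows "int (pebbling_number t G r) =
    Max {(\<Sum>i\<in>I. int (pebbling_number (ts i) (part i) r)) - int (card I) + 1 | ts.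
           (\<forall>i\<in>I. ts i \<ge> 1) \<and> (\<Sum>i\<in>I. ts i) = t + card I - 1}"
    (is "_ = Max ?M")
proof (rule Max_eqI[symmetric])
  have sum_iff: "(\<Sum>i\<in>I. ts i) = t + card I - 1 \<longleftrightarrow> (\<Sum>i\<in>I. ts i) + 1 = t + card I" for ts
    using assms(2) by linarith
  show upper: "x \<le> int (pebbling_number t G r)" if "x \<in> ?M" for x
  proof -
    from that obtain ts where ts: "\<forall>i\<in>I. ts i \<ge> 1" "(\<Sum>i\<in>I. ts i) + 1 = t + card I"
      and x: "x = (\<Sum>i\<in>I. int (pebbling_number (ts i) (part i) r)) - int (card I) + 1"
      unfolding sum_iff by blast
    show ?thesis
      using sum_pebbling_number_less[OF ts(1), of t] ts(2) unfolding x of_nat_sum[symmetric]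
      by linarith
  qed
  have "- int (card I) \<le> x" if "x \<in> ?M" for x
    using that by (auto simp flip: of_nat_sum)
  then have "?M \<subseteq> {- int (card I)..int (pebbling_number t G r)}"
    using upper by (intro subsetI) (simp only: atLeastAtMost_iff)
  then show "finite ?M" by (rule finite_subset) simp
  obtain ts where ts: "\<forall>i\<in>I. ts i \<ge> 1" "(\<Sum>i\<in>I. ts i) + 1 = t + card I"
    and le: "pebbling_number t G r + card I \<le> (\<Sum>i\<in>I. pebbling_number (ts i) (part i) r) + 1"
    using ex_pebbling_number_le_sum[OF assms] by blast
  have "int (pebbling_number t G r) =
      (\<Sum>i\<in>I. int (pebbling_number (ts i) (part i) r)) - int (card I) + 1"
    using sum_pebbling_number_less[OF ts(1), of t] ts(2) le unfolding of_nat_sum[symmetric]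
    by linarith
  then show "int (pebbling_number t G r) \<in> ?M"
    unfolding sum_iff using ts by blast
qed

end

section \<open>Components of symmetric digraphs\<close>

lemma strongly_connected_imp_connected:
  assumes "strongly_connected G"
  shows "Digraph_Component.connected G"
  using assms rtrancl_on_mono[of "arcs_ends G" "(arcs_ends G)\<^sup>s" "verts G" "verts G"]
  unfolding connected_conv strongly_connected_def reachable_def by (simp add: symcl_def)

lemma (in sym_digraph) connected_imp_strongly_connected_induced:
  assumes "subgraph H G" "Digraph_Component.connected H"
  shows "strongly_connected (G \<restriction> verts H)"
proof -
  have "induced_subgraph (G \<restriction> verts H) G"
    using assms(1) by (intro induced_induce) auto
  then interpret I: sym_digraph "G \<restriction> verts H"
    by (rule induced_graph_imp_graph)
  have "spanning H (G \<restriction> verts H)"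
    using subgraph_induce_subgraphI2[OF assms(1)] by (simp add: spanning_def)
  then show ?thesis
    using I.connected_spanning_imp_connected assms(2)
    by (intro I.symmetric_connected_imp_strongly_connected) auto
qed

lemma (in pre_digraph) max_subgraph_eqI:
  assumes "max_subgraph P H" "subgraph H H'" "subgraph H' G" "P H'"
  shows "H' = H"
  using assms by (auto simp: max_subgraph_def)

lemma (in sym_digraph) max_strongly_connected_imp_max_connected:
  assumes max: "max_subgraph strongly_connected H"
  shows "max_subgraph Digraph_Component.connected H"
proof (rule max_subgraphI)
  show "Digraph_Component.connected H"
    using max_subgraph_prop[OF max] by (rule strongly_connected_imp_connected)
  show "subgraph H G"
    using max by (rule subgraphI_max_subgraph)
  show "\<not> Digraph_Component.connected H'"
    if H': "H \<noteq> H'" "subgraph H H'" "subgraph H' G" for H'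
  proof
    assume "Digraph_Component.connected H'"
    with H'(3) have "strongly_connected (G \<restriction> verts H')"
      by (rule connected_imp_strongly_connected_induced)
    moreover have sub: "subgraph H' (G \<restriction> verts H')"
      using H'(3) by (rule subgraph_induce_subgraphI2)
    moreover have "subgraph (G \<restriction> verts H') G"
      using H'(3) by (intro subgraph_induce_subgraphI) auto
    ultimately have "G \<restriction> verts H' = H"
      using max_subgraph_eqI[OF max subgraph_trans[OF H'(2) sub]] by blast
    with sub have "subgraph H' H" by simp
    with H'(2) have "H = H'"
      by (intro pre_digraph.equality) (auto simp: subgraph_def compatible_def)
    with H'(1) show False by contradiction
  qed
qed

lemma (in sym_digraph) max_connected_imp_max_strongly_connected:
  assumes max: "max_subgraph Digraph_Component.connected H"
  shows "max_subgraph strongly_connected H"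
proof -
  have sub: "subgraph H G"
    using max by (rule subgraphI_max_subgraph)
  then have "subgraph (G \<restriction> verts H) G"
    by (intro subgraph_induce_subgraphI) auto
  moreover have sc: "strongly_connected (G \<restriction> verts H)"
    using sub max_subgraph_prop[OF max] by (rule connected_imp_strongly_connected_induced)
  ultimately have "G \<restriction> verts H = H"
    using max_subgraph_eqI[OF max subgraph_induce_subgraphI2[OF sub]] strongly_connected_imp_connected
    by blast
  with sc show ?thesis
    by (intro max_subgraph_mp[OF max strongly_connected_imp_connected]) simp_all
qed

lemma (in sym_digraph) components_eq_sccs: "components G = sccs"
  unfolding components_def sccs_altdef2
  using max_strongly_connected_imp_max_connected max_connected_imp_max_strongly_connected by blast

lemma (in pre_digraph) verts_component_subset: "H \<in> components G \<Longrightarrow> verts H \<subseteq> verts G"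
  unfolding components_def max_subgraph_def by auto

lemma (in sym_digraph) adj_in_component:
  assumes "H \<in> components G" "u \<in> verts H" "u \<rightarrow>\<^bsub>G\<^esub> v"
  shows "v \<in> verts H"
proof -
  have "verts H \<in> sccs_verts"
    using assms(1) by (simp add: components_eq_sccs sccs_verts_conv)
  moreover have "u \<rightarrow>\<^sup>*\<^bsub>G\<^esub> v" "v \<rightarrow>\<^sup>*\<^bsub>G\<^esub> u"
    using assms(3) by (auto intro: symmetric_reachable')
  ultimately show ?thesis
    using assms(2) unfolding in_sccs_verts_conv_reachable by blast
qed

lemma (in sym_digraph) ex1_component:
  assumes "v \<in> verts G"
  shows "\<exists>!H. H \<in> components G \<and> v \<in> verts H"
proof -
  obtain H where "H \<in> sccs" "verts H = scc_of v"
    using scc_of_in_sccs_verts[OF assms] unfolding sccs_verts_conv by (metis imageE)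
  then have "H \<in> components G" "v \<in> verts H"
    using in_scc_of_self[OF assms] by (simp_all add: components_eq_sccs)
  moreover have "H' = H" if "H' \<in> components G" "v \<in> verts H'" for H'
    using scc_disj[of H H'] calculation that unfolding components_eq_sccs by blast
  ultimately show ?thesis by blast
qed

lemma (in sym_digraph) ex_component_coloring:
  assumes "bij_betw Gs I (components G)"
  shows "\<exists>f. (\<forall>v\<in>verts G. f v \<in> I) \<and> (\<forall>i\<in>I. verts (Gs i) = {v \<in> verts G. f v = i}) \<and>
    (\<forall>u v. u \<rightarrow>\<^bsub>G\<^esub> v \<longrightarrow> f u = f v)"
proof -
  define f where "f v = inv_into I Gs (THE H. H \<in> components G \<and> v \<in> verts H)" for v
  have component: "Gs i \<in> components G" if "i \<in> I" for i
    using bij_betwE[OF assms] that by blast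
  have f_eq: "f v = i" if i: "i \<in> I" "v \<in> verts (Gs i)" for v i
  proof -
    have "v \<in> verts G"
      using verts_component_subset[OF component] i by blast
    then have "(THE H. H \<in> components G \<and> v \<in> verts H) = Gs i"
      using component i by (intro the1_equality ex1_component) simp_all
    then show ?thesis
      unfolding f_def using bij_betw_imp_inj_on[OF assms] i(1) by simp
  qed
  have f: "f v \<in> I \<and> v \<in> verts (Gs (f v))" if v: "v \<in> verts G" for v
  proof -
    obtain H where H: "H \<in> Gs ` I" "v \<in> verts H"
      using ex1_implies_ex[OF ex1_component[OF v]] bij_betw_imp_surj_on[OF assms] by blast
    then obtain i where "i \<in> I" "H = Gs i" by blast
    with H(2) show ?thesis by (simp add: f_eq)
  qed
  show ?thesis
  proof (intro exI[of _ f] conjI ballI allI impI)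
    show "f v \<in> I" if "v \<in> verts G" for v
      using f[OF that] by simp
    show "verts (Gs i) = {v \<in> verts G. f v = i}" if "i \<in> I" for i
      using f f_eq[OF that] verts_component_subset[OF component[OF that]] by auto
    show "f u = f v" if "u \<rightarrow>\<^bsub>G\<^esub> v" for u v
    proof -
      have "f u \<in> I" "u \<in> verts (Gs (f u))"
        using f that by (auto intro: adj_in_verts)
      then show ?thesis
        using f_eq[of "f u" v] adj_in_component[OF component _ that] by simp
    qed
  qed
qed

lemma verts_del_edges: "verts (del_edges G F) = verts G"
  by (simp add: del_edges_def)

lemma adj_del_edges_iff: "u \<rightarrow>\<^bsub>del_edges G F\<^esub> v \<longleftrightarrow> u \<rightarrow>\<^bsub>G\<^esub> v \<and> {u, v} \<notin> F"
  unfolding del_edges_def arcs_ends_conv by auto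

lemma adj_del_vert_iff:
  "u \<rightarrow>\<^bsub>pre_digraph.del_vert G r\<^esub> v \<longleftrightarrow> u \<rightarrow>\<^bsub>G\<^esub> v \<and> u \<noteq> r \<and> v \<noteq> r"
  unfolding arcs_ends_conv by (auto simp: pre_digraph.del_vert_simps)

lemma (in sym_digraph) sym_digraph_del_edges: "sym_digraph (del_edges G F)"
proof
  show "symmetric (del_edges G F)"
    using sym_arcs unfolding symmetric_def sym_def adj_del_edges_iff by (auto simp: insert_commute)
qed (auto simp: del_edges_def)

lemma (in sym_digraph) sym_digraph_del_vert: "sym_digraph (del_vert r)"
proof -
  interpret D: wf_digraph "del_vert r" by (rule wf_digraph_del_vert)
  show ?thesis
    by unfold_locales (use sym_arcs in \<open>auto simp: symmetric_def sym_def adj_del_vert_iff\<close>)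
qed

lemma (in sym_digraph) ex_coloring_del_vert_del_edges:
  assumes "bij_betw Gs I (components (del_edges (del_vert r) F))"
  shows "\<exists>f. (\<forall>v\<in>verts G - {r}. f v \<in> I) \<and>
    (\<forall>i\<in>I. verts (Gs i) = {v \<in> verts G. v \<noteq> r \<and> f v = i}) \<and>
    (\<forall>u v. u \<rightarrow>\<^bsub>G\<^esub> v \<and> u \<noteq> r \<and> v \<noteq> r \<and> f u \<noteq> f v \<longrightarrow> {u, v} \<in> F)"
proof -
  let ?K = "del_edges (del_vert r) F"
  have verts_K: "verts ?K = verts G - {r}"
    by (simp add: verts_del_edges verts_del_vert)
  have adj_K: "u \<rightarrow>\<^bsub>?K\<^esub> v \<longleftrightarrow> u \<rightarrow>\<^bsub>G\<^esub> v \<and> u \<noteq> r \<and> v \<noteq> r \<and> {u, v} \<notin> F" for u v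
    by (auto simp: adj_del_edges_iff adj_del_vert_iff)
  have "sym_digraph ?K"
    by (intro sym_digraph.sym_digraph_del_edges sym_digraph_del_vert)
  from sym_digraph.ex_component_coloring[OF this assms]
  obtain f where "\<forall>v\<in>verts ?K. f v \<in> I" "\<forall>i\<in>I. verts (Gs i) = {v \<in> verts ?K. f v = i}"
      "\<forall>u v. u \<rightarrow>\<^bsub>?K\<^esub> v \<longrightarrow> f u = f v"
    by (elim exE conjE)
  then show ?thesis
    unfolding adj_K by (intro exI[of _ f]) (auto simp: verts_K)
qed

theorem theorem17:
  fixes G :: "('a, 'b) pre_digraph"
    and r :: 'a
    and t j :: nat
    and E\<^sub>r :: "'a set set"
    and Gs :: "nat \<Rightarrow> ('a, 'b) pre_digraph"
  assumes "graph G"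
    and "Digraph_Component.connected G"
    and "r \<in> verts G"
    and "t \<ge> 1"
    and "E\<^sub>r \<subseteq> edges G"
    and "\<forall>e\<in>E\<^sub>r. \<forall>v\<in>e. r \<rightarrow>\<^bsub>G\<^esub> v"
    and "bij_betw Gs {1..j} (components (del_edges (pre_digraph.del_vert G r) E\<^sub>r))"
    and "j > 1"
  shows "int (pebbling_number t G r) =
    Max {(\<Sum>i=1..j. int (pebbling_number (ts i) (G \<restriction> (verts (Gs i) \<union> {r})) r)) - int j + 1 | ts :: nat \<Rightarrow> nat.
           (\<forall>i\<in>{1..j}. ts i \<ge> 1) \<and> (\<Sum>i=1..j. ts i) = t + j - 1}"
proof -
  interpret graph G by fact
  obtain f where f: "\<forall>v\<in>verts G - {r}. f v \<in> {1..j}"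
      "\<forall>i\<in>{1..j}. verts (Gs i) = {v \<in> verts G. v \<noteq> r \<and> f v = i}"
      "\<forall>u v. u \<rightarrow>\<^bsub>G\<^esub> v \<and> u \<noteq> r \<and> v \<noteq> r \<and> f u \<noteq> f v \<longrightarrow> {u, v} \<in> E\<^sub>r"
    using ex_coloring_del_vert_del_edges[OF assms(7)] by (elim exE conjE)
  interpret root_partition G r "{1..j}" f
  proof
    show "v \<rightarrow>\<^sup>*\<^bsub>G\<^esub> r" if "v \<in> verts G" for v
      using symmetric_connected_imp_strongly_connected[OF sym_arcs assms(2)] that assms(3) by blast
    show "u \<rightarrow>\<^bsub>G\<^esub> r" if "u \<rightarrow>\<^bsub>G\<^esub> v" "u \<noteq> r" "v \<noteq> r" "f u \<noteq> f v" for u v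
      using f(3) that assms(6) by (intro graph_symmetric[of r u]) blast
  qed (use assms(3) f(1) in auto)
  have "part i = G \<restriction> (verts (Gs i) \<union> {r})" if "i \<in> {1..j}" for i
    using f(2) that by (simp add: part_def)
  then have "(\<Sum>i=1..j. int (pebbling_number (ts i) (part i) r)) =
      (\<Sum>i=1..j. int (pebbling_number (ts i) (G \<restriction> (verts (Gs i) \<union> {r})) r))" for ts
    by (intro sum.cong) auto
  then show ?thesis
    using pebbling_number_eq_Max[OF _ assms(4)] assms(8) by simp
qed

end
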